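(* Let $H$ be a hypergraph, $f:V(H)\to(0,\infty)$ a function, and $M_H=(m_{ij})_{i,j\in V(H)}$ a real $f$-symmetric matrix indexed by $V(H)$. If $\mathfrak{R}$ is an equivalence relation on $V(H)$ that is finer than $\mathfrak{R}_{M_H}$, then for any $\mathfrak{R}$-equivalence class $W$ with $|W|\ge 2$, the vector space $C_W^f$ is an invariant subspace of $M_H$, i.e. $M_Hx\in C_W^f$ for all $x\in C_W^f$.
   Context: A hypergraph $H=(V(H),E(H))$ consists of a finite nonempty vertex set $V(H)$ and a finite family $E(H)$ of nonempty subsets of $V(H)$, called hyperedges. Vectors $x\in\mathbb{R}^{V(H)}$ are functions $x:V(H)\to\mathbb{R}$. For $f:V(H)\to(0,\infty)$, the inner product $(\cdot,\cdot)_f$ on $\mathbb{R}^{V(H)}$ is $(x,y)_f=\sum_{i\in V(H)}f(i)x(i)y(i)$. The matrix $M_H$ is $f$-symmetric if $(M_Hx,y)_f=(x,M_Hy)_f$ for all $x,y\in\mathbb{R}^{V(H)}$. $\mathfrak{R}_{M_H}$ is the equivalence relation on $V(H)$ consisting of the pairs $(i,j)$ such that $m_{ii}=m_{jj}$, $m_{ij}=m_{ji}$, and $m_{ik}=m_{jk}$, $m_{ki}=m_{kj}$ for all $k\notin\{i,j\}$. An equivalence relation $\mathfrak{R}_1$ is finer than an equivalence relation $\mathfrak{R}_2$ if $\mathfrak{R}_1\subseteq\mathfrak{R}_2$ (as sets of pairs). For $U\subseteq V(H)$, $C^f_U=\{x\in\mathbb{R}^{V(H)}: \text{there is } c_x\in\mathbb{R}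 \text{ with } f(i)x(i)=c_x \text{ for all } i\in U\}$. *)

theory Defs
  imports "HOL-Analysis.Analysis" "HOL-Library.Multiset"
begin

text \<open>The hyperedges form a finite family, so they are a multiset and repeated hyperedges are allowed.\<close>

definition hypergraph :: "'v set \<Rightarrow> 'v set multiset \<Rightarrow> bool" where
  "hypergraph V E \<longleftrightarrow> finite V \<and> V \<noteq> {} \<and> (\<forall>e\<in>#E. e \<noteq> {} \<and> e \<subseteq> V)"

text \<open>From here on the vertex set is a finite type \<^typ>\<open>'v\<close>, so that vectors and matrices indexed by
  the vertices are \<^typ>\<open>real ^ 'v\<close> and \<^typ>\<open>real ^ 'v ^ 'v\<close>, with entry $m_{ij}$ written
  \<open>M $ i $ j\<close>.\<close>

definition weighted_inner :: "('v \<Rightarrow> real) \<Rightarrow> real ^ 'v \<Rightarrow> real ^ 'v \<Rightarrow> real" where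
  "weighted_inner f x y = (\<Sum>i\<in>UNIV. f i * x $ i * y $ i)"

definition f_symmetric :: "('v::finite \<Rightarrow> real) \<Rightarrow> real ^ 'v ^ 'v \<Rightarrow> bool" where
  "f_symmetric f M \<longleftrightarrow> (\<forall>x y. weighted_inner f (M *v x) y = weighted_inner f x (M *v y))"

definition matrix_rel :: "real ^ 'v ^ 'v \<Rightarrow> ('v \<times> 'v) set" where
  "matrix_rel M = {(i, j). M $ i $ i = M $ j $ j \<and> M $ i $ j = M $ j $ i \<and>
     (\<forall>k. k \<notin> {i, j} \<longrightarrow> M $ i $ k = M $ j $ k \<and> M $ k $ i = M $ k $ j)}"

lemma equiv_matrix_rel: "equiv UNIV (matrix_rel M)"
proof (intro equivI)
  show "trans (matrix_rel M)"
  proof (rule transI)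
    fix i j k assume ij: "(i, j) \<in> matrix_rel M" and jk: "(j, k) \<in> matrix_rel M"
    show "(i, k) \<in> matrix_rel M"
    proof (cases "i = j \<or> j = k \<or> i = k")
      case True
      then show ?thesis using ij jk by (auto simp: matrix_rel_def)
    next
      case False
      have ij': "M $ i $ i = M $ j $ j" "M $ i $ j = M $ j $ i"
        "\<And>l. l \<noteq> i \<Longrightarrow> l \<noteq> j \<Longrightarrow> M $ i $ l = M $ j $ l \<and> M $ l $ i = M $ l $ j"
        using ij by (auto simp: matrix_rel_def)
      have jk': "M $ j $ j = M $ k $ k" "M $ j $ k = M $ k $ j"
        "\<And>l. l \<noteq> j \<Longrightarrow> l \<noteq> k \<Longrightarrow> M $ j $ l = M $ k $ l \<and> M $ l $ j = M $ l $ k"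
        using jk by (auto simp: matrix_rel_def)
      have k: "M $ i $ k = M $ j $ k" "M $ k $ i = M $ k $ j" using ij'(3)[of k] False by auto
      have i: "M $ j $ i = M $ k $ i" "M $ i $ j = M $ i $ k" using jk'(3)[of i] False by auto
      have "M $ i $ l = M $ k $ l \<and> M $ l $ i = M $ l $ k" if "l \<noteq> i" "l \<noteq> k" for l
      proof (cases "l = j")
        case True
        then show ?thesis using k i ij'(2) jk'(2) by simp
      next
        case False
        then show ?thesis using ij'(3)[of l] jk'(3)[of l] that by simp
      qed
      then show ?thesis using k ij'(1) jk'(1,2) by (simp add: matrix_rel_def)
    qed
  qed
qed (auto simp: matrix_rel_def refl_on_def sym_def)

definition const_space :: "('v \<Rightarrow> real) \<Rightarrow> 'v set \<Rightarrow> (real ^ 'v) set" where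
  "const_space f U = {x. \<exists>c. \<forall>i\<in>U. f i * x $ i = c}"

definition invariant_subspace :: "real ^ 'v ^ 'v \<Rightarrow> (real ^ 'v::finite) set \<Rightarrow> bool" where
  "invariant_subspace M S \<longleftrightarrow> subspace S \<and> (\<forall>x\<in>S. M *v x \<in> S)"

end

theory Submission
  imports Defs
begin

text \<open>
  Let \<open>y k = f k * x $ k\<close> be the weighted vector. Testing \<open>f\<close>-symmetry against the basis vectors
  shows that \<open>M\<close> acts on weighted vectors by its transpose: the weighted \<open>i\<close>-th entry of \<open>M *v x\<close>
  pairs \<open>y\<close> with the \<open>i\<close>-th column of \<open>M\<close> (lemma \<open>weighted_mult_eq_column_sum\<close>). For \<open>(i, j)\<close> in
  \<open>matrix_rel M\<close>, the \<open>i\<close>-th and \<open>j\<close>-th columns arise from each other by exchanging the rows \<open>i\<close>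
  and \<open>j\<close>. If \<open>y\<close> takes the same value at \<open>i\<close> and \<open>j\<close>, this exchange does not change the pairing
  (lemma \<open>weighted_mult_eq_of_matrix_rel\<close>). Since any two elements of \<open>W\<close> are related, this says
  that the weighted entries of \<open>M *v x\<close> are constant on \<open>W\<close> when those of \<open>x\<close> are.
\<close>

lemma subspace_const_space: "subspace (const_space f W)"
proof (rule subspaceI)
  show "0 \<in> const_space f W"
    by (auto simp: const_space_def)
next
  fix x y assume "x \<in> const_space f W" "y \<in> const_space f W"
  then obtain c d where "\<forall>i\<in>W. f i * x $ i = c" "\<forall>i\<in>W. f i * y $ i = d"
    by (auto simp: const_space_def)
  then have "\<forall>i\<in>W. f i * (x + y) $ i = c + d"
    by (simp add: distrib_left)
  then show "x + y \<in> const_space f W"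
    by (auto simp: const_space_def)
next
  fix r x assume "x \<in> const_space f W"
  then obtain c where "\<forall>i\<in>W. f i * x $ i = c"
    by (auto simp: const_space_def)
  then have "\<forall>i\<in>W. f i * (r *\<^sub>R x) $ i = r * c"
    by (simp add: mult.left_commute)
  then show "r *\<^sub>R x \<in> const_space f W"
    unfolding const_space_def by blast
qed

lemma const_space_iff_pairwise:
  "x \<in> const_space f W \<longleftrightarrow> (\<forall>i\<in>W. \<forall>j\<in>W. f i * x $ i = f j * x $ j)"
proof
  assume "x \<in> const_space f W"
  then show "\<forall>i\<in>W. \<forall>j\<in>W. f i * x $ i = f j * x $ j"
    by (auto simp: const_space_def)
next
  assume eq: "\<forall>i\<in>W. \<forall>j\<in>W. f i * x $ i = f j * x $ j"
  show "x \<in> const_space f W"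
  proof (cases "W = {}")
    case False
    then obtain j where "j \<in> W" by blast
    with eq have "\<forall>i\<in>W. f i * x $ i = f j * x $ j" by blast
    then show ?thesis unfolding const_space_def by blast
  qed (simp add: const_space_def)
qed

text \<open>
  The two sides are the two sides of the symmetry condition for \<open>x\<close> and the \<open>i\<close>-th basis vector.
  Columns are preferred to rows because in \<open>f i * M $ i $ k\<close> the weight would depend on \<open>i\<close>,
  whereas here \<open>i\<close> enters only through the matrix.
\<close>

lemma weighted_mult_eq_column_sum:
  fixes M :: "real ^ 'v ^ 'v::finite"
  assumes "f_symmetric f M"
  shows "f i * (M *v x) $ i = (\<Sum>k\<in>UNIV. M $ k $ i * (f k * x $ k))"
proof -
  have "f i * (M *v x) $ i = weighted_inner f (M *v x) (axis i 1)"
    by (simp add: weighted_inner_def axis_def if_distrib cong: if_cong)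
  also have "\<dots> = weighted_inner f x (M *v axis i 1)"
    using assms by (simp add: f_symmetric_def)
  also have "\<dots> = (\<Sum>k\<in>UNIV. M $ k $ i * (f k * x $ k))"
    by (simp add: weighted_inner_def matrix_vector_mul_component inner_axis mult.commute)
  finally show ?thesis .
qed

text \<open>
  The matrix relation says that exchanging the rows \<open>i\<close> and \<open>j\<close> turns the \<open>j\<close>-th column into the
  \<open>i\<close>-th, so the two column sums are reindexings of each other by a transposition.
\<close>

lemma weighted_mult_eq_of_matrix_rel:
  fixes M :: "real ^ 'v ^ 'v::finite"
  assumes "f_symmetric f M" and rel: "(i, j) \<in> matrix_rel M"
    and eq: "f i * x $ i = f j * x $ j"
  shows "f i * (M *v x) $ i = f j * (M *v x) $ j"
proof -
  let ?t = "Transposition.transpose i j"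
  have "(\<Sum>k\<in>UNIV. M $ k $ i * (f k * x $ k))
      = (\<Sum>k\<in>UNIV. M $ (?t k) $ j * (f (?t k) * x $ (?t k)))"
  proof (rule sum.cong[OF refl])
    fix k
    have "M $ k $ i = M $ (?t k) $ j"
      using rel by (auto simp: matrix_rel_def Transposition.transpose_def)
    moreover have "f k * x $ k = f (?t k) * x $ (?t k)"
      using eq by (simp add: Transposition.transpose_def)
    ultimately show "M $ k $ i * (f k * x $ k) = M $ (?t k) $ j * (f (?t k) * x $ (?t k))"
      by simp
  qed
  also have "\<dots> = (\<Sum>k\<in>UNIV. M $ k $ j * (f k * x $ k))"
    by (rule sum.reindex_bij_betw) simp
  finally show ?thesis
    using assms(1) by (simp add: weighted_mult_eq_column_sum)
qed

theorem theorem2p7: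
  fixes E :: "'v::finite set multiset"
    and f :: "'v \<Rightarrow> real"
    and M :: "real ^ 'v ^ 'v"
    and R :: "('v \<times> 'v) set"
    and W :: "'v set"
  assumes "hypergraph (UNIV :: 'v set) E"
    and "\<And>i. 0 < f i"
    and "f_symmetric f M"
    and "equiv UNIV R"
    and "R \<subseteq> matrix_rel M"
    and "W \<in> UNIV // R"
    and "2 \<le> card W"
  shows "invariant_subspace M (const_space f W)"
proof -
  have rel: "(i, j) \<in> matrix_rel M" if "i \<in> W" "j \<in> W" for i j
    using quotient_eq_iff[OF assms(4) assms(6) assms(6) that] assms(5) by auto
  have "M *v x \<in> const_space f W" if x: "x \<in> const_space f W" for x
    unfolding const_space_iff_pairwise
  proof (intro ballI)
    fix i j assume "i \<in> W" "j \<in> W"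
    moreover from this x have "f i * x $ i = f j * x $ j"
      unfolding const_space_iff_pairwise by blast
    ultimately show "f i * (M *v x) $ i = f j * (M *v x) $ j"
      using assms(3) rel weighted_mult_eq_of_matrix_rel by blast
  qed
  then show ?thesis
    by (simp add: invariant_subspace_def subspace_const_space)
qed

end
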